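(* Let $p\ge 1$, let $\mu,\beta\in\mathbf{R}^p$, let $A$ be a full-rank $p\times p$ real matrix, let $X$ be a scalar random variable supported on $(0,\infty)$, and let $Z$ be a $p\times 1$ standard normal vector independent of $X$. Let $f(y)$, $y\in\mathbf{R}^p$, denote the density of $Y=\mu+\beta X+\sqrt{X}\,AZ$. Suppose $\beta\ne 0$. Then for each $t\in\mathbf{R}$ the density $f$ has ellipsoidal contours on the hyperplane $$\mathcal{H}_t=\mu+\beta t+\left\{z\in\mathbf{R}^p:\ z^\top(AA^\top)^{-1}\beta=0\right\};$$ specifically, for $y\in\mathcal{H}_t$, $f(y)$ depends only on $\|A^{-1}(y-\mu-\beta t)\|$, i.e. if $y,y'\in\mathcal{H}_t$ satisfy $\|A^{-1}(y-\mu-\beta t)\|=\|A^{-1}(y'-\mu-\beta t)\|$, then $f(y)=f(y')$.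
   Context: $\|\cdot\|$ denotes the Euclidean norm. The density of $Y$ is taken to be the mixture density $f(y)=\mathrm{E}\left[(2\pi X)^{-p/2}|\det A|^{-1}\exp\left(-\frac{\|A^{-1}(y-\mu-\beta X)\|^2}{2X}\right)\right]$ (if $X$ has density $g$, this is the corresponding integral against $g(x)\,dx$ over $(0,\infty)$); the value $+\infty$ is allowed at $y=\mu$. *)

theory Defs
  imports "HOL-Probability.Probability"
begin

definition standard_normal_vector :: "'a measure \<Rightarrow> ('a \<Rightarrow> real ^ 'n) \<Rightarrow> bool" where
  "standard_normal_vector M Z \<longleftrightarrow>
     distributed M lborel Z (\<lambda>z. ennreal (\<Prod>i\<in>UNIV. std_normal_density (z $ i)))"

text \<open>The library's \<open>indep_var\<close> forces both variables to have the same type; this is the same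
  notion for variables with values in different Borel spaces.\<close>

definition independent_rvs ::
  "'a measure \<Rightarrow> ('a \<Rightarrow> 'b::topological_space) \<Rightarrow> ('a \<Rightarrow> 'c::topological_space) \<Rightarrow> bool" where
  "independent_rvs M X Z \<longleftrightarrow>
     X \<in> borel_measurable M \<and> Z \<in> borel_measurable M \<and>
     prob_space.indep_set M {X -` B \<inter> space M |B. B \<in> sets borel}
                            {Z -` B \<inter> space M |B. B \<in> sets borel}"

text \<open>Conditionally on \<open>X = x > 0\<close>, the vector \<open>\<mu> + x \<beta> + \<surd>x A Z\<close> is normal with mean \<open>\<mu> + x \<beta>\<close> and
  covariance \<open>x A A\<^sup>T\<close>; the density below averages the conditional densities over \<open>X\<close>. It is
  extended-valued because the expectation can be infinite at \<open>y = \<mu>\<close>.\<close>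

definition normal_mixture_density ::
  "'a measure \<Rightarrow> ('a \<Rightarrow> real) \<Rightarrow> real ^ 'n \<Rightarrow> real ^ 'n \<Rightarrow> real ^ 'n ^ 'n \<Rightarrow> real ^ 'n \<Rightarrow> ennreal" where
  "normal_mixture_density M X \<mu> \<beta> A y =
     (\<integral>\<^sup>+ \<omega>. ennreal ((2 * pi * X \<omega>) powr (- real CARD('n) / 2) * inverse \<bar>det A\<bar> *
        exp (- (norm (matrix_inv A *v (y - \<mu> - X \<omega> *\<^sub>R \<beta>)))\<^sup>2 / (2 * X \<omega>))) \<partial>M)"

definition contour_hyperplane ::
  "real ^ 'n \<Rightarrow> real ^ 'n \<Rightarrow> real ^ 'n ^ 'n \<Rightarrow> real \<Rightarrow> (real ^ 'n) set" where
  "contour_hyperplane \<mu> \<beta> A t =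
     (\<lambda>z. \<mu> + t *\<^sub>R \<beta> + z) ` {z. z \<bullet> (matrix_inv (A ** transpose A) *v \<beta>) = 0}"

text \<open>The rest of the theory shows that \<open>normal_mixture_density M X \<mu> \<beta> A\<close> is indeed a density of
  \<open>\<mu> + X \<beta> + \<surd>X A Z\<close> (lemma \<open>distributed_normal_mixture_density\<close>).\<close>

text \<open>Unlike \<open>measure_linear_image\<close>, this does not require a well-ordered index type.\<close>

lemma measure_matrix_image:
  fixes A :: "real ^ 'n ^ 'n"
  assumes "S \<in> lmeasurable"
  shows "(*v) A ` S \<in> lmeasurable \<and> measure lebesgue ((*v) A ` S) = \<bar>det A\<bar> * measure lebesgue S"
proof -
  let ?P = "\<lambda>A :: real ^ 'n ^ 'n. \<forall>S\<in>lmeasurable.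
    (*v) A ` S \<in> lmeasurable \<and> measure lebesgue ((*v) A ` S) = \<bar>det A\<bar> * measure lebesgue S"
  have suff: "?P A" if "\<And>a b. cbox a b \<noteq> {} \<Longrightarrow> measure lebesgue ((*v) A ` cbox a b) = \<bar>det A\<bar> * measure lebesgue (cbox a b)"
    for A :: "real ^ 'n ^ 'n"
  proof
    fix S :: "(real ^ 'n) set" assume "S \<in> lmeasurable"
    have "measure lebesgue ((*v) A ` cbox a b) = \<bar>det A\<bar> * measure lebesgue (cbox a b)" for a b
      using that[of a b] by (cases "cbox a b = {}") simp_all
    from measure_linear_sufficient[OF matrix_vector_mul_linear \<open>S \<in> lmeasurable\<close> this]
    show "(*v) A ` S \<in> lmeasurable \<and> measure lebesgue ((*v) A ` S) = \<bar>det A\<bar> * measure lebesgue S"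
      by simp
  qed
  have "?P A"
  proof (rule induct_matrix_elementary_alt[of ?P])
    fix A B :: "real ^ 'n ^ 'n"
    assume "?P A" "?P B"
    then show "?P (A ** B)"
      unfolding matrix_vector_mult_matrix_matrix_mult_compose image_comp[symmetric] det_mul abs_mult
      by (simp add: mult.assoc)
  next
    fix A :: "real ^ 'n ^ 'n" and i
    assume "row i A = 0"
    then have d: "det A = 0" by (rule det_zero_row)
    then have "\<not> inj ((*v) A)"
      using det_nz_iff_inj[OF matrix_vector_mul_linear, of A] by simp
    then have n: "negligible ((*v) A ` S)" for S
      using negligible_linear_singular_image[OF matrix_vector_mul_linear] by blast
    show "?P A"
      using n by (simp add: d negligible_iff_measure)
  next
    fix A :: "real ^ 'n ^ 'n"
    assume 0: "\<And>i j. i \<noteq> j \<Longrightarrow> A $ i $ j = 0"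
    have "A $ i $ i * x $ i = (\<Sum>j\<in>UNIV. A $ i $ j * x $ j)" for x and i :: 'n
      by (simp add: 0 comm_monoid_add_class.sum.remove[where x = i])
    then have "(*v) A = (\<lambda>x. \<chi> i. A $ i $ i * x $ i)"
      by (auto simp: matrix_vector_mult_def)
    then show "?P A"
      using measurable_stretch measure_stretch by (auto simp: det_diagonal[OF 0])
  next
    fix m n :: 'n
    assume "m \<noteq> n"
    let ?t = "Transposition.transpose m n"
    let ?A = "(\<chi> i j. mat 1 $ i $ ?t j) :: real ^ 'n ^ 'n"
    have f: "?A *v x = (\<chi> i. x $ ?t i)" for x
    proof -
      have "(if i = ?t j then 1 else 0) * x $ j = (if j = ?t i then x $ j else 0)" for i j
        by auto
      then show ?thesis by (simp add: vec_eq_iff matrix_vector_mult_def mat_def)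
    qed
    have d: "\<bar>det ?A\<bar> = 1"
      by (simp add: det_permute_columns permutes_swap_id sign_swap_id abs_mult)
    show "?P ?A"
    proof (rule suff)
      fix a b :: "real ^ 'n" assume ne: "cbox a b \<noteq> {}"
      have eq: "(*v) ?A ` cbox a b = cbox (\<chi> i. a $ ?t i) (\<chi> i. b $ ?t i)"
        unfolding f by (auto simp: image_iff lambda_swap_Galois mem_box_cart) (metis transpose_involutory)+
      moreover have "cbox (\<chi> i. a $ ?t i) (\<chi> i. b $ ?t i) \<noteq> {}"
        using ne eq by blast
      ultimately show "measure lebesgue ((*v) ?A ` cbox a b) = \<bar>det ?A\<bar> * measure lebesgue (cbox a b)"
        using ne prod.permute[OF permutes_swap_id, where S=UNIV and g="\<lambda>i. (b - a) $ i", symmetric]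
        by (simp add: d content_cbox_cart)
    qed
  next
    fix m n :: 'n
    assume mn: "m \<noteq> n"
    let ?A = "(\<chi> i j. of_bool (i = m \<and> j = n \<or> i = j)) :: real ^ 'n ^ 'n"
    have f: "?A *v x = (\<chi> i. if i = m then x $ m + x $ n else x $ i)" for x
    proof -
      have "of_bool (i = m \<and> j = n \<or> i = j) * x $ j =
        (if j = i then x $ j else 0) + (if j = n then (if i = m then x $ j else 0) else 0)" for i j
        using mn by auto
      then show ?thesis by (simp add: vec_eq_iff matrix_vector_mult_def sum.distrib)
    qed
    have "?A = (\<chi> k. if k = m then row m (mat 1) + 1 *s row n (mat 1) else row k (mat 1))"
      using mn by (auto simp: vec_eq_iff row_def mat_def)
    then have d: "det ?A = 1"
      using det_row_operation[OF mn, of "mat 1" "1::real"] by simp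
    show "?P ?A"
    proof (rule suff)
      fix a b :: "real ^ 'n" assume ne: "cbox a b \<noteq> {}"
      let ?v = "- axis n (a $ n)"
      have "0 \<le> (?v + a) $ n" by (simp add: axis_def)
      moreover have ne': "cbox (?v + a) (?v + b) \<noteq> {}"
        using ne by (simp only: cbox_translation image_is_empty not_False_eq_True)
      ultimately have "measure lebesgue ((*v) ?A ` cbox (?v + a) (?v + b)) = measure lebesgue (cbox (?v + a) (?v + b))"
        unfolding f using mn by (intro measure_shear_interval)
      moreover have "(*v) ?A ` cbox (?v + a) (?v + b) = (+) (?A *v ?v) ` ((*v) ?A ` cbox a b)"
        unfolding cbox_translation image_image by (simp only: matrix_vector_right_distrib)
      ultimately show "measure lebesgue ((*v) ?A ` cbox a b) = \<bar>det ?A\<bar> * measure lebesgue (cbox a b)"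
        by (simp only: measure_translation d cbox_translation abs_one mult_1)
    qed
  qed
  with assms show ?thesis by blast
qed

lemma lborel_linear:
  fixes C :: "real ^ 'n ^ 'n"
  assumes d: "det C \<noteq> 0"
  shows "lborel = density (distr lborel borel ((*v) C)) (\<lambda>_. ennreal \<bar>det C\<bar>)"
proof (rule lborel_eqI)
  obtain D where D: "C ** D = mat 1" "D ** C = mat 1"
    using d invertible_det_nz[of C] unfolding invertible_def by auto
  have DC: "D *v (C *v x) = x" "C *v (D *v x) = x" for x
    by (simp_all add: matrix_vector_mul_assoc D)
  have cont: "continuous_on UNIV ((*v) C)"
    by (intro linear_continuous_on matrix_vector_mul_bounded_linear)
  have [measurable]: "(*v) C \<in> borel_measurable borel"
    by (intro borel_measurable_continuous_onI cont)
  fix l u :: "real ^ 'n"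
  assume le: "\<And>b. b \<in> Basis \<Longrightarrow> l \<bullet> b \<le> u \<bullet> b"
  have vi: "(*v) C -` box l u = (*v) D ` box l u"
    by (auto simp: image_iff DC) (metis DC(1))
  have box: "box l u \<in> lmeasurable" by simp
  have op: "open ((*v) D ` box l u)"
    unfolding vi[symmetric]
    by (intro open_vimage open_box cont)
  have m: "measure lebesgue ((*v) D ` box l u) = \<bar>det D\<bar> * measure lebesgue (box l u)"
    using measure_matrix_image[OF box, of D] by simp
  have "(*v) D ` box l u \<in> lmeasurable"
    using measure_matrix_image[OF box, of D] by simp
  then have "emeasure lebesgue ((*v) D ` box l u) = ennreal (\<bar>det D\<bar> * measure lebesgue (box l u))"
    using emeasure_eq_measure2 m by metis
  then have e: "emeasure lborel ((*v) D ` box l u) = ennreal (\<bar>det D\<bar> * measure lborel (box l u))"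
    using op by (simp add: borel_open)
  have dd: "\<bar>det C\<bar> * \<bar>det D\<bar> = 1"
    by (metis D(1) abs_mult abs_one det_I det_mul)
  have "emeasure (density (distr lborel borel ((*v) C)) (\<lambda>_. ennreal \<bar>det C\<bar>)) (box l u)
      = ennreal \<bar>det C\<bar> * emeasure lborel ((*v) C -` box l u)"
    by (subst emeasure_density_const) (auto simp: emeasure_distr)
  also have "\<dots> = ennreal (measure lborel (box l u))"
    unfolding vi e using dd by (simp add: ennreal_mult[symmetric] mult.assoc[symmetric])
  also have "\<dots> = (\<Prod>b\<in>Basis. (u - l) \<bullet> b)"
    using le by (simp add: measure_lborel_box_eq inner_diff_left)
  finally show "emeasure (density (distr lborel borel ((*v) C)) (\<lambda>_. ennreal \<bar>det C\<bar>)) (box l u)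
      = (\<Prod>b\<in>Basis. (u - l) \<bullet> b)" .
qed simp

lemma prod_std_normal_density:
  fixes z :: "real ^ 'n"
  shows "(\<Prod>i\<in>UNIV. std_normal_density (z $ i)) = (2 * pi) powr (- real CARD('n) / 2) * exp (- (norm z)\<^sup>2 / 2)"
proof -
  have s: "1 / sqrt (2 * pi) = (2 * pi) powr (- 1 / 2)"
    by (simp add: powr_half_sqrt[symmetric] powr_minus_divide)
  have "(\<Sum>i\<in>UNIV. - (z $ i)\<^sup>2 / 2) = - (norm z)\<^sup>2 / 2"
    by (simp add: norm_vec_def L2_set_def sum_nonneg sum_negf sum_divide_distrib)
  then show ?thesis
    by (simp add: std_normal_density_def prod.distrib exp_sum[symmetric] s powr_powr[symmetric]
        powr_realpow[symmetric] powr_powr)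
qed

lemma mixture_kernel:
  fixes A :: "real ^ 'n ^ 'n"
  assumes "0 < x"
  shows "(2 * pi * x) powr (- real CARD('n) / 2) * inverse \<bar>det A\<bar> *
           exp (- (norm (matrix_inv A *v v))\<^sup>2 / (2 * x)) =
         inverse \<bar>det (sqrt x *\<^sub>R A)\<bar> *
           (\<Prod>i\<in>UNIV. std_normal_density ((inverse (sqrt x) *\<^sub>R (matrix_inv A *v v)) $ i))"
proof -
  have "sqrt x *\<^sub>R A = (\<chi> i. sqrt x *s (A $ i))"
    by (simp add: vec_eq_iff)
  then have "det (sqrt x *\<^sub>R A) = sqrt x ^ CARD('n) * det A"
    using det_rows_mul[of "\<lambda>_. sqrt x" "\<lambda>i. A $ i"] by simp
  moreover have "inverse (sqrt x ^ CARD('n)) = x powr (- real CARD('n) / 2)"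
    using assms by (simp add: powr_half_sqrt[symmetric] powr_realpow[symmetric] powr_powr powr_minus)
  ultimately have "inverse \<bar>det (sqrt x *\<^sub>R A)\<bar> = x powr (- real CARD('n) / 2) * inverse \<bar>det A\<bar>"
    using assms by (simp add: abs_mult)
  moreover have "- (norm (inverse (sqrt x) *\<^sub>R (matrix_inv A *v v)))\<^sup>2 / 2 = - (norm (matrix_inv A *v v))\<^sup>2 / (2 * x)"
    using assms by (simp add: power_mult_distrib power_divide field_simps)
  ultimately show ?thesis
    unfolding prod_std_normal_density using assms by (simp only: powr_mult mult_ac)
qed

lemma matrix_vector_borel [measurable]: "(*v) C \<in> borel_measurable borel" for C :: "real ^ 'n ^ 'm"
  by (intro borel_measurable_continuous_onI linear_continuous_on matrix_vector_mul_bounded_linear)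

lemma nn_integral_affine:
  fixes C :: "real ^ 'n ^ 'n"
  assumes d: "det C \<noteq> 0" and [measurable]: "g \<in> borel_measurable borel"
  shows "(\<integral>\<^sup>+ y. g y \<partial>lborel) = ennreal \<bar>det C\<bar> * (\<integral>\<^sup>+ z. g (b + C *v z) \<partial>lborel)"
proof -
  have "(\<integral>\<^sup>+ y. g y \<partial>lborel) = (\<integral>\<^sup>+ y. g (b + y) \<partial>lborel)"
    by (subst lborel_distr_plus[of b, symmetric]) (simp add: nn_integral_distr)
  also have "\<dots> = ennreal \<bar>det C\<bar> * (\<integral>\<^sup>+ z. g (b + C *v z) \<partial>lborel)"
    by (subst lborel_linear[OF d])
       (simp add: nn_integral_density nn_integral_distr nn_integral_cmult)
  finally show ?thesis .
qed

lemma independent_rvs_distr: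
  fixes X :: "'a \<Rightarrow> 'b::second_countable_topology" and Z :: "'a \<Rightarrow> 'c::second_countable_topology"
  assumes "prob_space M" "independent_rvs M X Z"
  shows "distr M borel X \<Otimes>\<^sub>M distr M borel Z = distr M (borel \<Otimes>\<^sub>M borel) (\<lambda>\<omega>. (X \<omega>, Z \<omega>))"
proof -
  interpret prob_space M by fact
  have [measurable]: "X \<in> borel_measurable M" "Z \<in> borel_measurable M"
    and ind: "\<And>A B. A \<in> sets borel \<Longrightarrow> B \<in> sets borel \<Longrightarrow>
      prob ((X -` A \<inter> space M) \<inter> (Z -` B \<inter> space M)) = prob (X -` A \<inter> space M) * prob (Z -` B \<inter> space M)"
    using assms(2) unfolding independent_rvs_def indep_sets2_eq by (simp_all, blast)
  interpret X: prob_space "distr M borel X" by (rule prob_space_distr) measurable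
  interpret Z: prob_space "distr M borel Z" by (rule prob_space_distr) measurable
  show ?thesis
  proof (rule pair_measure_eqI)
    fix A :: "'b set" and B :: "'c set"
    assume "A \<in> sets (distr M borel X)" "B \<in> sets (distr M borel Z)"
    then have [measurable]: "A \<in> sets borel" "B \<in> sets borel" by auto
    have "(\<lambda>\<omega>. (X \<omega>, Z \<omega>)) -` (A \<times> B) \<inter> space M = (X -` A \<inter> space M) \<inter> (Z -` B \<inter> space M)"
      by auto
    then show "emeasure (distr M borel X) A * emeasure (distr M borel Z) B =
        emeasure (distr M (borel \<Otimes>\<^sub>M borel) (\<lambda>\<omega>. (X \<omega>, Z \<omega>))) (A \<times> B)"
      using ind[of A B]
      by (simp add: emeasure_distr emeasure_eq_measure ennreal_mult)
  qed (auto intro: X.sigma_finite_measure_axioms Z.sigma_finite_measure_axioms)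
qed

lemma distributed_normal_mixture_density:
  fixes A :: "real ^ 'n ^ 'n"
  assumes M: "prob_space M" and A: "rank A = CARD('n)"
    and X: "X \<in> borel_measurable M" and pos: "AE \<omega> in M. X \<omega> \<in> {0<..}"
    and Z: "standard_normal_vector M Z" and XZ: "independent_rvs M X Z"
  shows "distributed M lborel (\<lambda>\<omega>. \<mu> + X \<omega> *\<^sub>R \<beta> + sqrt (X \<omega>) *\<^sub>R (A *v Z \<omega>))
           (normal_mixture_density M X \<mu> \<beta> A)"
proof -
  interpret prob_space M by fact
  define \<phi> where "\<phi> = (\<lambda>z::real ^ 'n. ennreal (\<Prod>i\<in>UNIV. std_normal_density (z $ i)))"
  define k where "k = (\<lambda>x y. ennreal ((2 * pi * x) powr (- real CARD('n) / 2) * inverse \<bar>det A\<bar> *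
        exp (- (norm (matrix_inv A *v (y - \<mu> - x *\<^sub>R \<beta>)))\<^sup>2 / (2 * x))))"
  have \<phi>[measurable]: "\<phi> \<in> borel_measurable borel"
    unfolding \<phi>_def prod_std_normal_density by measurable
  have k[measurable]: "case_prod k \<in> borel_measurable (borel \<Otimes>\<^sub>M borel)"
    unfolding k_def by measurable
  note [measurable] = X
  have DZ: "distr M borel Z = density lborel \<phi>" and [measurable]: "Z \<in> borel_measurable M"
    using Z unfolding standard_normal_vector_def distributed_def \<phi>_def
    by (auto cong: distr_cong)
  define DX where "DX = distr M borel X"
  interpret DX: prob_space DX unfolding DX_def by (rule prob_space_distr) measurable
  have [measurable_cong, simp]: "sets DX = sets borel" by (simp add: DX_def)
  have posX: "AE x in DX. 0 < x"
    using pos unfolding DX_def by (subst AE_distr_iff) simp_all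
  interpret P: pair_sigma_finite DX "lborel :: (real ^ 'n) measure" ..
  have f: "normal_mixture_density M X \<mu> \<beta> A = (\<lambda>y. \<integral>\<^sup>+ x. k x y \<partial>DX)"
    by (simp add: fun_eq_iff normal_mixture_density_def k_def DX_def nn_integral_distr)
  have detA: "det A \<noteq> 0"
    using A det_eq_0_rank[of A] by simp
  have inv: "matrix_inv A *v (A *v z) = z" for z
  proof -
    have "\<exists>B. A ** B = mat 1 \<and> B ** A = mat 1"
      using detA invertible_det_nz[of A] by (simp add: invertible_def)
    from someI_ex[OF this] have "matrix_inv A ** A = mat 1"
      by (simp add: matrix_inv_def)
    then show ?thesis by (simp add: matrix_vector_mul_assoc)
  qed
  let ?Y = "\<lambda>x z. \<mu> + x *\<^sub>R \<beta> + sqrt x *\<^sub>R (A *v z)"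
  have cv: "(\<integral>\<^sup>+ z. \<phi> z * h (?Y x z) \<partial>lborel) = (\<integral>\<^sup>+ y. k x y * h y \<partial>lborel)"
    if x: "0 < x" and [measurable]: "h \<in> borel_measurable borel" for x and h :: "real ^ 'n \<Rightarrow> ennreal"
  proof -
    let ?C = "sqrt x *\<^sub>R A"
    have C: "?C *v z = sqrt x *\<^sub>R (A *v z)" for z
      by (simp add: scaleR_matrix_vector_assoc)
    have detC: "det ?C \<noteq> 0"
    proof -
      have "?C = (\<chi> i. sqrt x *s (A $ i))"
        by (simp add: vec_eq_iff)
      then show ?thesis
        using det_rows_mul[of "\<lambda>_. sqrt x" "\<lambda>i. A $ i"] detA x by simp
    qed
    have kk: "k x (?Y x z) = ennreal (inverse \<bar>det ?C\<bar>) * \<phi> z" for z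
      using x unfolding k_def mixture_kernel[OF x] \<phi>_def
      by (simp add: ennreal_mult prod_nonneg matrix_vector_mult_scaleR inv)
    have "(\<integral>\<^sup>+ y. k x y * h y \<partial>lborel) =
        ennreal \<bar>det ?C\<bar> * (\<integral>\<^sup>+ z. ennreal (inverse \<bar>det ?C\<bar>) * (\<phi> z * h (?Y x z)) \<partial>lborel)"
      by (subst nn_integral_affine[OF detC, of _ "\<mu> + x *\<^sub>R \<beta>"]) (simp_all add: C kk mult.assoc)
    also have "\<dots> = ennreal (\<bar>det ?C\<bar> * inverse \<bar>det ?C\<bar>) * (\<integral>\<^sup>+ z. \<phi> z * h (?Y x z) \<partial>lborel)"
      by (subst nn_integral_cmult) (simp_all add: ennreal_mult mult.assoc)
    finally show ?thesis using detC by simp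
  qed
  have "distr M lborel (\<lambda>\<omega>. ?Y (X \<omega>) (Z \<omega>)) = density lborel (\<lambda>y. \<integral>\<^sup>+ x. k x y \<partial>DX)"
  proof (rule measure_eqI)
    fix B assume "B \<in> sets (distr M lborel (\<lambda>\<omega>. ?Y (X \<omega>) (Z \<omega>)))"
    then have B[measurable]: "B \<in> sets borel" by simp
    interpret DZ: prob_space "distr M borel Z" by (rule prob_space_distr) measurable
    have "emeasure (distr M lborel (\<lambda>\<omega>. ?Y (X \<omega>) (Z \<omega>))) B = (\<integral>\<^sup>+ y. indicator B y \<partial>distr M lborel (\<lambda>\<omega>. ?Y (X \<omega>) (Z \<omega>)))"
      by simp
    also have "\<dots> = (\<integral>\<^sup>+ \<omega>. indicator B (?Y (X \<omega>) (Z \<omega>)) \<partial>M)"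
      by (subst nn_integral_distr) simp_all
    also have "\<dots> = (\<integral>\<^sup>+ p. indicator B (?Y (fst p) (snd p)) \<partial>distr M (borel \<Otimes>\<^sub>M borel) (\<lambda>\<omega>. (X \<omega>, Z \<omega>)))"
      by (subst nn_integral_distr) simp_all
    also have "\<dots> = (\<integral>\<^sup>+ x. \<integral>\<^sup>+ z. indicator B (?Y x z) \<partial>distr M borel Z \<partial>DX)"
      unfolding independent_rvs_distr[OF M XZ, symmetric] DX_def
      by (subst DZ.nn_integral_fst[symmetric]) simp_all
    also have "\<dots> = (\<integral>\<^sup>+ x. \<integral>\<^sup>+ z. \<phi> z * indicator B (?Y x z) \<partial>lborel \<partial>DX)"
      unfolding DZ by (simp add: nn_integral_density)
    also have "\<dots> = (\<integral>\<^sup>+ x. \<integral>\<^sup>+ y. k x y * indicator B y \<partial>lborel \<partial>DX)"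
      using posX by (intro nn_integral_cong_AE) (auto simp: cv elim!: eventually_mono)
    also have "\<dots> = (\<integral>\<^sup>+ y. \<integral>\<^sup>+ x. k x y * indicator B y \<partial>DX \<partial>lborel)"
      by (rule P.Fubini'[symmetric]) measurable
    also have "\<dots> = emeasure (density lborel (\<lambda>y. \<integral>\<^sup>+ x. k x y \<partial>DX)) B"
      by (simp add: emeasure_density nn_integral_multc)
    finally show "emeasure (distr M lborel (\<lambda>\<omega>. ?Y (X \<omega>) (Z \<omega>))) B =
      emeasure (density lborel (\<lambda>y. \<integral>\<^sup>+ x. k x y \<partial>DX)) B" .
  qed simp
  then show ?thesis
    unfolding distributed_def f by auto
qed

end

theory Submission
  imports Defs
begin

text \<open>On \<open>\<H>\<^sub>t\<close> the vectors \<open>A\<^sup>-\<^sup>1(y - \<mu> - t\<beta>)\<close> and \<open>A\<^sup>-\<^sup>1\<beta>\<close> are orthogonal, because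
  \<open>(AA\<^sup>T)\<^sup>-\<^sup>1\<close> is the Gram matrix of \<open>A\<^sup>-\<^sup>1\<close>. By Pythagoras the exponent of the mixture kernel at
  \<open>X = x\<close> then depends on \<open>y\<close> only through \<open>\<parallel>A\<^sup>-\<^sup>1(y - \<mu> - t\<beta>)\<parallel>\<close>, for every \<open>x\<close>.\<close>

lemma matrix_inv:
  assumes "invertible A"
  shows matrix_inv_right: "A ** matrix_inv A = mat 1" and matrix_inv_left: "matrix_inv A ** A = mat 1"
  using someI_ex[OF assms[unfolded invertible_def]] unfolding matrix_inv_def by auto

lemma inner_matrix_inv_mult:
  fixes A :: "real ^ 'n ^ 'n"
  assumes "invertible A"
  shows "(matrix_inv A *v z) \<bullet> (matrix_inv A *v b) = z \<bullet> (matrix_inv (A ** transpose A) *v b)"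
proof -
  \<comment> \<open>Since \<open>w\<close> solves \<open>A ** transpose A *v w = b\<close>, the
    vector \<open>matrix_inv A *v b\<close> is \<open>transpose A *v w\<close>. Moving
    \<open>transpose A\<close> across the inner product then cancels the inverse in front of
    \<open>z\<close>.\<close>
  define w where "w = matrix_inv (A ** transpose A) *v b"
  have inv: "invertible (A ** transpose A)"
    using assms by (simp add: invertible_mult transpose_invertible)
  have "b = A *v (transpose A *v w)"
    using matrix_inv_right[OF inv] by (simp add: w_def matrix_vector_mul_assoc matrix_mul_assoc)
  then have "matrix_inv A *v b = transpose A *v w"
    using matrix_inv_left[OF assms] by (metis matrix_vector_mul_assoc matrix_vector_mul_lid)
  moreover have "A *v (matrix_inv A *v z) = z"
    using matrix_inv_right[OF assms] by (simp add: matrix_vector_mul_assoc)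
  ultimately show ?thesis
    by (metis dot_lmul_matrix inner_commute transpose_matrix_vector w_def)
qed

text \<open>The second summand is free of \<open>y\<close>, so two points of one hyperplane whose
  norms agree for \<open>t\<close> also have equal norms for every real \<open>x\<close>.\<close>

lemma norm_matrix_inv_contour:
  fixes A :: "real ^ 'n ^ 'n"
  assumes "invertible A" "y \<in> contour_hyperplane \<mu> \<beta> A t"
  shows "(norm (matrix_inv A *v (y - \<mu> - x *\<^sub>R \<beta>)))\<^sup>2 =
           (norm (matrix_inv A *v (y - \<mu> - t *\<^sub>R \<beta>)))\<^sup>2 + (norm ((t - x) *\<^sub>R (matrix_inv A *v \<beta>)))\<^sup>2"
proof -
  obtain z where y: "y = \<mu> + t *\<^sub>R \<beta> + z"
    and z: "z \<bullet> (matrix_inv (A ** transpose A) *v \<beta>) = 0"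
    using assms(2) unfolding contour_hyperplane_def by auto
  \<comment> \<open>The offset from the conditional mean at \<open>X = x\<close> splits into a
    direction of the hyperplane and a multiple of \<open>\<beta>\<close>.\<close>
  have "y - \<mu> - x *\<^sub>R \<beta> = z + (t - x) *\<^sub>R \<beta>"
    by (simp add: y algebra_simps)
  then have "matrix_inv A *v (y - \<mu> - x *\<^sub>R \<beta>) = matrix_inv A *v z + (t - x) *\<^sub>R (matrix_inv A *v \<beta>)"
    by (simp add: matrix_vector_right_distrib matrix_vector_mult_scaleR)
  moreover have "orthogonal (matrix_inv A *v z) ((t - x) *\<^sub>R (matrix_inv A *v \<beta>))"
    using z by (simp add: orthogonal_def inner_matrix_inv_mult[OF assms(1)])
  ultimately show ?thesis
    by (simp add: y norm_add_Pythagorean)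
qed

theorem proposition1:
  fixes M :: "'a measure" and X :: "'a \<Rightarrow> real" and Z Y :: "'a \<Rightarrow> real ^ 'n"
    and \<mu> \<beta> :: "real ^ 'n" and A :: "real ^ 'n ^ 'n" and f :: "real ^ 'n \<Rightarrow> ennreal"
  assumes "prob_space M"
    and "rank A = CARD('n)"
    and "X \<in> borel_measurable M" and "AE \<omega> in M. X \<omega> \<in> {0<..}"
    and "standard_normal_vector M Z"
    and "independent_rvs M X Z"
    and "Y = (\<lambda>\<omega>. \<mu> + X \<omega> *\<^sub>R \<beta> + sqrt (X \<omega>) *\<^sub>R (A *v Z \<omega>))"
    and "distributed M lborel Y f"
    and "f = normal_mixture_density M X \<mu> \<beta> A"
    and "\<beta> \<noteq> 0"
  shows "\<forall>t. \<forall>y \<in> contour_hyperplane \<mu> \<beta> A t. \<forall>y' \<in> contour_hyperplane \<mu> \<beta> A t.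
           norm (matrix_inv A *v (y - \<mu> - t *\<^sub>R \<beta>)) = norm (matrix_inv A *v (y' - \<mu> - t *\<^sub>R \<beta>)) \<longrightarrow>
           f y = f y'"
proof (intro allI ballI impI)
  fix t y y'
  assume "y \<in> contour_hyperplane \<mu> \<beta> A t" "y' \<in> contour_hyperplane \<mu> \<beta> A t"
    and "norm (matrix_inv A *v (y - \<mu> - t *\<^sub>R \<beta>)) = norm (matrix_inv A *v (y' - \<mu> - t *\<^sub>R \<beta>))"
  moreover have "invertible A"
    using assms(2) det_eq_0_rank[of A] by (simp add: invertible_det_nz)
  ultimately have "(norm (matrix_inv A *v (y - \<mu> - x *\<^sub>R \<beta>)))\<^sup>2 = (norm (matrix_inv A *v (y' - \<mu> - x *\<^sub>R \<beta>)))\<^sup>2" for x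
    by (metis norm_matrix_inv_contour)
  \<comment> \<open>Taking \<open>x\<close> as \<open>X \<omega>\<close> makes the integrands equal
    at every \<open>\<omega>\<close>, so the integrals agree even where they are infinite.\<close>
  then show "f y = f y'"
    unfolding assms(9) normal_mixture_density_def by (simp only:)
qed

end
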